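(* Fix $\epsilon$ with $0<\epsilon<1/2$. For a positive integer $N$, let $g:\{0,1\}^{N^2}\to\{0,1\}$ be the two-level AND--OR tree $$g(x_1,\dots,x_{N^2})=\bigwedge_{i=1}^{N}\ \bigvee_{j=(i-1)N+1}^{iN}x_j .$$ Then any real polynomial approximating $g$ has degree $\Omega(N^{2/3})$; that is, there is a constant $c>0$, depending only on $\epsilon$, such that for all sufficiently large $N$ every polynomial $p(x_1,\dots,x_{N^2})$ approximating $g$ has degree at least $cN^{2/3}$.
   Context: A real polynomial $p(x_1,\dots,x_{N^2})$ approximates $g$ (with the fixed parameter $\epsilon$) if for every $(x_1,\dots,x_{N^2})\in\{0,1\}^{N^2}$: $0\le p(x_1,\dots,x_{N^2})\le\epsilon$ whenever $g(x_1,\dots,x_{N^2})=0$, and $1-\epsilon\le p(x_1,\dots,x_{N^2})\le 1$ whenever $g(x_1,\dots,x_{N^2})=1$. *)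

theory Defs
  imports Complex_Main "HOL-Library.Poly_Mapping"
begin

text \<open>A monomial is the finitely supported map sending each variable index to its exponent;
  a polynomial maps each monomial to its coefficient.\<close>

type_synonym monomial = "nat \<Rightarrow>\<^sub>0 nat"
type_synonym real_mpoly = "monomial \<Rightarrow>\<^sub>0 real"

definition mpoly_vars :: "real_mpoly \<Rightarrow> nat set" where
  "mpoly_vars p = (\<Union>m\<in>Poly_Mapping.keys p. Poly_Mapping.keys m)"

definition mpoly_eval :: "(nat \<Rightarrow> real) \<Rightarrow> real_mpoly \<Rightarrow> real" where
  "mpoly_eval x p =
     (\<Sum>m\<in>Poly_Mapping.keys p. Poly_Mapping.lookup p m *
       (\<Prod>i\<in>Poly_Mapping.keys m. x i ^ Poly_Mapping.lookup m i))"

definition monomial_degree :: "monomial \<Rightarrow> nat" where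
  "monomial_degree m = (\<Sum>i\<in>Poly_Mapping.keys m. Poly_Mapping.lookup m i)"

text \<open>Total degree; the zero polynomial gets degree 0.\<close>

definition mpoly_degree :: "real_mpoly \<Rightarrow> nat" where
  "mpoly_degree p = Max (insert 0 (monomial_degree ` Poly_Mapping.keys p))"

text \<open>A point of the Boolean cube \<open>{0,1}\<^sup>n\<close> is the restriction of some \<open>x :: nat \<Rightarrow> bool\<close> to
  the coordinates \<open>1, \<dots>, n\<close>; the tree of order \<open>N\<close> and any polynomial in variables \<open>1, \<dots>, N\<^sup>2\<close>
  do not depend on the values of \<open>x\<close> elsewhere.\<close>

definition and_or_tree :: "nat \<Rightarrow> (nat \<Rightarrow> bool) \<Rightarrow> bool" where
  "and_or_tree N x \<longleftrightarrow> (\<forall>i\<in>{1..N}. \<exists>j\<in>{(i - 1) * N + 1..i * N}. x j)"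

definition approximates ::
    "real \<Rightarrow> real_mpoly \<Rightarrow> ((nat \<Rightarrow> bool) \<Rightarrow> bool) \<Rightarrow> bool" where
  "approximates \<epsilon> p g \<longleftrightarrow>
     (\<forall>x. let v = mpoly_eval (\<lambda>i. of_bool (x i)) p in
        (\<not> g x \<longrightarrow> 0 \<le> v \<and> v \<le> \<epsilon>) \<and> (g x \<longrightarrow> 1 - \<epsilon> \<le> v \<and> v \<le> 1))"

end

theory Submission
  imports Defs "HOL-Library.FuncSet" "HOL-Library.Disjoint_Sets"
begin

text \<open>There are probability weights \<open>u\<close>, \<open>v\<close> on \<open>{0..N}\<close> that agree on all polynomials of degree at
  most \<open>d\<close>, where \<open>d\<close> is of order \<open>\<surd>N\<close>, although \<open>u 0 \<ge> 1 - \<eta>\<close> and \<open>v 0 = 0\<close>. Spread uniformly over the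
  subsets of each size, they become distributions on the subsets of an \<open>N\<close>-element set that cannot be
  told apart by monomials in at most \<open>d\<close> variables.

  Given a set \<open>Z\<close> of blocks, draw the input of block \<open>i\<close> from \<open>u\<close> if \<open>i \<in> Z\<close> and from \<open>v\<close> otherwise,
  and let \<open>q Z\<close> be the expected value of the approximating polynomial. Then \<open>q {} \<ge> 1 - \<epsilon>\<close>, as under
  \<open>v\<close> no block is empty, and \<open>q Z \<le> \<epsilon> + \<eta>\<close> for \<open>Z \<noteq> {}\<close>, as any block in \<open>Z\<close> is empty with probability
  at least \<open>1 - \<eta>\<close>. Now draw \<open>Z\<close> itself from \<open>u\<close> or from \<open>v\<close>. A monomial with fewer than \<open>(d + 1)\<^sup>2\<close>
  variables meets at most \<open>d\<close> blocks in more than \<open>d\<close> variables, so its contribution to \<open>q Z\<close> depends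
  on at most \<open>d\<close> of the bits \<open>i \<in> Z\<close>; if all monomials are of this kind, the two expectations of \<open>q Z\<close>
  coincide. But the first is at least \<open>(1 - \<eta>) (1 - \<epsilon>)\<close> and the second at most \<open>\<epsilon> + \<eta>\<close>. Hence the
  degree is at least \<open>(d + 1)\<^sup>2\<close>, which is even of order \<open>N\<close>.\<close>

section \<open>Divided differences vanish on polynomials of low degree\<close>

text \<open>The Lagrange form of Newton's divided difference: the coefficient of degree
  \<open>card S - 1\<close> in the interpolant of \<open>f\<close> at the nodes
  \<open>S\<close>.\<close>

definition divided_difference :: "nat set \<Rightarrow> (nat \<Rightarrow> real) \<Rightarrow> real" where
  "divided_difference S f = (\<Sum>t\<in>S. f t / (\<Prod>s\<in>S - {t}. real t - real s))"

lemma divided_difference_add: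
  "divided_difference S (\<lambda>t. f t + g t) = divided_difference S f + divided_difference S g"
  by (simp add: divided_difference_def add_divide_distrib sum.distrib)

lemma divided_difference_cmult:
  "divided_difference S (\<lambda>t. c * f t) = c * divided_difference S f"
  by (simp add: divided_difference_def sum_distrib_left)

text \<open>The new factor kills the term at \<open>a\<close> and cancels the factor belonging to
  \<open>a\<close> in every other denominator. This trades one degree for one node.\<close>

lemma divided_difference_mult_node:
  assumes "finite S" "a \<in> S"
  shows "divided_difference S (\<lambda>t. (real t - real a) * f t) = divided_difference (S - {a}) f"
proof -
  have "(real t - real a) * f t / (\<Prod>s\<in>S - {t}. real t - real s) =
        f t / (\<Prod>s\<in>S - {a} - {t}. real t - real s)" if "t \<in> S - {a}" for t
  proof -
    have "(\<Prod>s\<in>S - {t}. real t - real s) = (real t - real a) * (\<Prod>s\<in>S - {t} - {a}. real t - real s)"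
      using that assms by (intro prod.remove) auto
    moreover have "S - {t} - {a} = S - {a} - {t}" by auto
    ultimately show ?thesis using that by simp
  qed
  moreover have "divided_difference S (\<lambda>t. (real t - real a) * f t) =
      (\<Sum>t\<in>S - {a}. (real t - real a) * f t / (\<Prod>s\<in>S - {t}. real t - real s))"
    using assms unfolding divided_difference_def by (subst sum.remove[of _ a]) auto
  ultimately show ?thesis by (simp add: divided_difference_def)
qed

text \<open>For nodes \<open>a \<noteq> b\<close>, the constant \<open>b - a\<close> is
  \<open>(t - a) - (t - b)\<close>, so the claim reduces to \<open>S - {a}\<close> and
  \<open>S - {b}\<close>. With two nodes both reductions give 1 by the empty product; with more,
  both vanish by induction.\<close>

lemma divided_difference_one:
  assumes "finite S" "2 \<le> card S"
  shows "divided_difference S (\<lambda>t. 1) = 0"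
  using assms
proof (induction "card S" arbitrary: S rule: less_induct)
  case less
  have fin: "finite S" by fact
  obtain a b where S: "a \<in> S" "b \<in> S" "a \<noteq> b"
    using card_le_Suc0_iff_eq[OF fin] less.prems by fastforce
  have eq: "divided_difference (S - {a}) (\<lambda>t. 1) = divided_difference (S - {b}) (\<lambda>t. 1)"
  proof (cases "card S = 2")
    case True
    then have "S = {a, b}" using S by (metis card_2_iff doubleton_eq_iff insert_iff singletonD)
    moreover have "{a, b} - {a} = {b}" "{a, b} - {b} = {a}" using S by auto
    ultimately show ?thesis by (simp add: divided_difference_def)
  next
    case False
    then have c: "card (S - {a}) \<ge> 2" "card (S - {b}) \<ge> 2" using less.prems S by auto
    moreover have "card (S - {a}) < card S" "card (S - {b}) < card S"
      using card_Diff1_less[OF fin] S by blast+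
    ultimately show ?thesis using less.hyps fin by simp
  qed
  have "(real b - real a) * divided_difference S (\<lambda>t. 1) =
      divided_difference S (\<lambda>t. (real t - real a) * 1 + (-1) * ((real t - real b) * 1))"
    by (subst divided_difference_cmult[symmetric]) simp
  also have "\<dots> = 0"
    unfolding divided_difference_add divided_difference_cmult
      divided_difference_mult_node[OF fin S(1)] divided_difference_mult_node[OF fin S(2)]
    using eq by simp
  finally show ?case using S by simp
qed

text \<open>Split the last factor as \<open>t - r = (t - b) + (b - r)\<close> with a node
  \<open>b\<close>: the first part removes \<open>b\<close>, the second is a constant, and the
  shorter product vanishes on both node sets.\<close>

lemma divided_difference_falling:
  assumes "finite S" "r + 2 \<le> card S"
  shows "divided_difference S (\<lambda>t. \<Prod>i<r. real t - real i) = 0"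
  using assms
proof (induction r arbitrary: S)
  case 0
  then show ?case by (simp add: divided_difference_one)
next
  case (Suc r)
  then obtain b where b: "b \<in> S" by fastforce
  let ?g = "\<lambda>t. \<Prod>i<r. real t - real i"
  have "divided_difference S (\<lambda>t. \<Prod>i<Suc r. real t - real i) =
     divided_difference S (\<lambda>t. (real t - real b) * ?g t + (real b - real r) * ?g t)"
    by (intro arg_cong[of _ _ "divided_difference S"] ext) (simp add: algebra_simps)
  also have "\<dots> = 0"
    unfolding divided_difference_add divided_difference_cmult
      divided_difference_mult_node[OF Suc.prems(1) b]
    using Suc.IH[of S] Suc.IH[of "S - {b}"] Suc.prems b by simp
  finally show ?case .
qed

lemma divided_difference_choose:
  assumes "finite S" "r + 2 \<le> card S"
  shows "divided_difference S (\<lambda>t. real (t choose r)) = 0"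
proof -
  have "real (t choose r) = 1 / fact r * (\<Prod>i<r. real t - real i)" for t
    by (simp add: binomial_gbinomial gbinomial_prod_rev atLeast0LessThan)
  then have "divided_difference S (\<lambda>t. real (t choose r)) =
      divided_difference S (\<lambda>t. 1 / fact r * (\<Prod>i<r. real t - real i))" by simp
  also have "\<dots> = 1 / fact r * divided_difference S (\<lambda>t. \<Prod>i<r. real t - real i)"
    by (rule divided_difference_cmult)
  finally show ?thesis using divided_difference_falling[OF assms] by simp
qed

section \<open>Signed weights at scaled squares and the moment-matching pair\<close>

text \<open>Each factor is \<open>(j - i) * (j + i)\<close>. The factors \<open>j - i\<close>
  complete \<open>fact (j - k - 1)\<close> to \<open>fact (j - 1)\<close>; then \<open>j\<close> and
  the factors \<open>j + i\<close> extend this to \<open>fact (j + k)\<close>.\<close>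

lemma prod_diff_squares_below:
  assumes "k < j"
  shows "(\<Prod>i\<in>{1..k}. \<bar>real j^2 - real i^2\<bar>) * (real j * fact (j - k - 1)) = fact (j + k)"
  using assms
proof (induction k)
  case 0
  then show ?case by (cases j) (auto)
next
  case (Suc k)
  have f: "fact (j - k - 1) = (real j - real (Suc k)) * fact (j - Suc k - 1)"
    using Suc.prems by (cases "j - k - 1") (auto simp: of_nat_diff Suc_diff_Suc)
  have a: "\<bar>real j^2 - real (Suc k)^2\<bar> = (real j - real (Suc k)) * (real j + real (Suc k))"
    using Suc.prems by (simp add: power2_eq_square square_diff_square_factored abs_mult)
  have "(\<Prod>i\<in>{1..Suc k}. \<bar>real j^2 - real i^2\<bar>) * (real j * fact (j - Suc k - 1)) =
    (\<Prod>i\<in>{1..k}. \<bar>real j^2 - real i^2\<bar>) * (real j * fact (j - k - 1)) * (real j + real (Suc k))"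
    unfolding f using a by (simp del: of_nat_Suc)
  also have "\<dots> = fact (j + k) * (real j + real (Suc k))" using Suc by simp
  also have "\<dots> = fact (j + Suc k)" by (simp add: algebra_simps)
  finally show ?case .
qed

text \<open>Induction on \<open>m\<close> from \<open>j\<close>: the node \<open>m + 1\<close>
  contributes \<open>(m + 1 - j) * (m + 1 + j)\<close>, exactly the growth of the two
  factorials.\<close>

lemma prod_diff_squares:
  assumes "1 \<le> j" "j \<le> m"
  shows "(\<Prod>i\<in>{1..m} - {j}. \<bar>real j^2 - real i^2\<bar>) * (2 * real j^2) = fact (m - j) * fact (m + j)"
  using assms(2)
proof (induction m rule: dec_induct)
  case base
  have "{1..j} - {j} = {1..j-1}" using assms by auto
  moreover have "fact (j + j) = (2 * real j) * fact (j + (j - 1))"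
    using assms by (cases j) (auto)
  ultimately show ?case using prod_diff_squares_below[of "j-1" j] assms
    by (simp add: power2_eq_square)
next
  case (step m)
  have "{1..Suc m} - {j} = insert (Suc m) ({1..m} - {j})" using step assms by auto
  moreover have "\<bar>real j^2 - real (Suc m)^2\<bar> = (real (Suc m) - real j) * (real (Suc m) + real j)"
    using step by (simp add: power2_eq_square square_diff_square_factored abs_mult)
  moreover have "fact (Suc m - j) = (real (Suc m) - real j) * fact (m - j)"
    using step by (simp add: Suc_diff_le of_nat_diff)
  moreover have "fact (Suc m + j) = (real (Suc m) + real j) * fact (m + j)" by simp
  ultimately show ?case using step.IH by (simp add: mult_ac)
qed

text \<open>Each increase of \<open>j\<close> replaces a factor \<open>m - j\<close> by the larger
  \<open>m + j + 1\<close>.\<close>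

lemma fact_square_le:
  assumes "j \<le> m"
  shows "fact m ^ 2 \<le> fact (m - j) * (fact (m + j) :: real)"
  using assms
proof (induction j)
  case 0
  then show ?case by (simp add: power2_eq_square)
next
  case (Suc j)
  have "(fact (m - j) * fact (m + j) :: real) = fact (m - Suc j) * fact (m + j) * real (m - j)"
    using Suc.prems by (cases "m - j") (auto simp: Suc_diff_Suc diff_Suc)
  also have "\<dots> \<le> fact (m - Suc j) * fact (m + j) * real (Suc (m + j))"
    by (intro mult_left_mono) auto
  also have "\<dots> = fact (m - Suc j) * fact (m + Suc j)" by (simp add: algebra_simps)
  finally show ?case using Suc by linarith
qed

text \<open>After multiplication by \<open>j^2\<close> the left side is \<open>fact m ^ 2\<close>
  and the right side is \<open>fact (m - j) * fact (m + j)\<close>. The constant 2 is uniform in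
  \<open>j\<close> and \<open>m\<close>, as the weights below require.\<close>

lemma prod_square_ratio_le:
  assumes "1 \<le> j" "j \<le> m"
  shows "(\<Prod>i\<in>{1..m} - {j}. real i^2) \<le> 2 * (\<Prod>i\<in>{1..m} - {j}. \<bar>real j^2 - real i^2\<bar>)"
proof -
  have "(\<Prod>i\<in>{1..m} - {j}. real i^2) * real j^2 = (\<Prod>i\<in>{1..m}. real i^2)"
    using assms by (subst prod.remove[of "{1..m}" j]) auto
  also have "\<dots> = fact m ^ 2" by (simp add: fact_prod prod_power_distrib)
  also have "\<dots> \<le> 2 * (\<Prod>i\<in>{1..m} - {j}. \<bar>real j^2 - real i^2\<bar>) * real j^2"
    using fact_square_le[OF assms(2)] prod_diff_squares[OF assms] by (simp add: mult_ac)
  finally show ?thesis using assms by simp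
qed

lemma sum_inverse_squares_le: "(\<Sum>j\<in>{1..m}. 1 / real j^2) \<le> 2 - 1 / real m"
proof (induction m)
  case 0
  then show ?case by simp
next
  case (Suc m)
  show ?case
  proof (cases "m = 0")
    case False
    then have "1 / real (Suc m)^2 \<le> 1 / real m - 1 / real (Suc m)"
      by (simp add: divide_simps power2_eq_square) 
    then show ?thesis using Suc by simp
  qed simp
qed

text \<open>The weights are the coefficients of the divided difference at the nodes \<open>0\<close>, \<open>1\<close> and
  \<open>c i\<^sup>2\<close> with \<open>1 \<le> i \<le> m\<close>. For the nodes \<open>i\<^sup>2\<close> alone the coefficients decay too slowly; the
  additional node \<open>1\<close> gains the factor \<open>1 / (c j\<^sup>2 - 1)\<close>, whose sum over \<open>j\<close> is small for large \<open>c\<close>.\<close>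
lemma ex_signed_weights:
  fixes c m N :: nat
  assumes "2 \<le> c" "1 \<le> N" "c * m^2 \<le> N"
  shows "\<exists>a :: nat \<Rightarrow> real. a 0 = 1 \<and> (\<Sum>t\<in>{2..N}. \<bar>a t\<bar>) \<le> 4 / (real c - 1) \<and>
    (\<forall>r\<le>m. (\<Sum>t\<le>N. a t * real (t choose r)) = 0)"
proof -
  define P where "P = (\<lambda>i. c * i^2) ` {1..m}"
  define S where "S = {0, 1} \<union> P"
  define \<phi> where "\<phi> = (\<lambda>t. 1 / (\<Prod>s\<in>S - {t}. real t - real s))"
  \<comment> \<open>Division by \<open>\<phi> 0\<close> normalises the weight at 0 to 1.\<close>
  define a where "a = (\<lambda>t. if t \<in> S then \<phi> t / \<phi> 0 else 0)"
  have ge: "2 \<le> c * i^2" if "1 \<le> i" for i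
    using mult_mono[of 2 c 1 "i^2"] that assms(1) by simp
  have P2: "2 \<le> t" if "t \<in> P" for t using ge that by (auto simp: P_def)
  have finP: "finite P" by (simp add: P_def)
  have inj: "inj_on (\<lambda>i. c * i^2) A" for A
    using assms(1) by (auto simp: inj_on_def)
  have finS: "finite S" by (simp add: S_def finP)
  have notP: "0 \<notin> P" "1 \<notin> P" using P2 by fastforce+
  \<comment> \<open>With \<open>m + 2\<close> nodes, all binomial moments up to order
    \<open>m\<close> vanish.\<close>
  have cardS: "card S = m + 2"
    using notP finP by (simp add: S_def) (simp add: P_def card_image[OF inj])
  have "c * i^2 \<le> N" if "i \<in> {1..m}" for i
    using that assms(3) by (meson atLeastAtMost_iff le_trans mult_le_mono2 power_mono zero_le)
  then have SN: "S \<subseteq> {..N}" using assms(2) by (auto simp: S_def P_def)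
  have \<phi>0: "\<phi> 0 \<noteq> 0" using finS by (auto simp: \<phi>_def)
  have mom: "(\<Sum>t\<le>N. a t * real (t choose r)) = 0" if "r \<le> m" for r
  proof -
    have "(\<Sum>t\<le>N. a t * real (t choose r)) = (\<Sum>t\<in>S. a t * real (t choose r))"
      using SN by (intro sum.mono_neutral_right) (auto simp: a_def)
    also have "\<dots> = (\<Sum>t\<in>S. real (t choose r) / (\<Prod>s\<in>S - {t}. real t - real s)) / \<phi> 0"
      unfolding sum_divide_distrib by (intro sum.cong) (auto simp: a_def \<phi>_def)
    also have "\<dots> = 0"
      using divided_difference_choose[OF finS, of r] that cardS by (simp add: divided_difference_def)
    finally show ?thesis .
  qed
  \<comment> \<open>The denominators of \<open>\<phi> 0\<close> and \<open>\<phi> (c * j^2)\<close>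
    share the factor \<open>c * j^2\<close> and the same power of \<open>c\<close>; the quotient
    collapses to \<open>(?A / ?B) / (c * j^2 - 1)\<close>.\<close>
  have bound: "\<bar>a (c * j^2)\<bar> \<le> 2 / ((real c - 1) * real j^2)" if j: "j \<in> {1..m}" for j
  proof -
    let ?J = "{1..m} - {j}" and ?t = "c * j^2"
    let ?A = "\<Prod>i\<in>?J. real i^2" and ?B = "\<Prod>i\<in>?J. \<bar>real j^2 - real i^2\<bar>"
    have tP: "?t \<in> P" unfolding P_def using j by (rule imageI)
    have Pt: "P - {?t} = (\<lambda>i. c * i^2) ` ?J"
      unfolding P_def using inj[of UNIV] by (subst image_set_diff) auto
    have c1: "c \<noteq> Suc 0" using assms(1) by simp
    have t2: "\<bar>real ?t - 1\<bar> = real ?t - 1" "2 \<le> ?t" using P2[OF tP] by linarith+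
    define R where "R = P - {?t}"
    have R: "finite R" "?t \<notin> R" "0 \<notin> R" "1 \<notin> R" using finP notP by (auto simp: R_def)
    have "S - {0} = insert 1 (insert ?t R)" using notP tP by (auto simp: S_def R_def)
    then have "\<bar>\<Prod>s\<in>S - {0}. real 0 - real s\<bar> = real ?t * (\<Prod>s\<in>R. real s)"
      using R c1 P2[OF tP] by (simp add: abs_mult abs_prod)
    also have "(\<Prod>s\<in>R. real s) = real c ^ card ?J * ?A"
      by (simp add: R_def Pt prod.reindex[OF inj] prod.distrib)
    finally have 0: "\<bar>\<phi> 0\<bar> = 1 / (real ?t * (real c ^ card ?J * ?A))" by (simp add: \<phi>_def)
    have "S - {?t} = insert 0 (insert 1 R)" using notP tP P2[OF tP] by (auto simp: S_def R_def)
    then have "\<bar>\<Prod>s\<in>S - {?t}. real ?t - real s\<bar>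
        = real ?t * ((real ?t - 1) * (\<Prod>s\<in>R. \<bar>real ?t - real s\<bar>))"
      using R c1 t2 by (simp add: abs_mult abs_prod)
    also have "(\<Prod>s\<in>R. \<bar>real ?t - real s\<bar>) = (\<Prod>i\<in>?J. real c * \<bar>real j^2 - real i^2\<bar>)"
      unfolding R_def Pt prod.reindex[OF inj] o_def
      by (intro prod.cong) (auto simp: abs_mult right_diff_distrib[symmetric])
    also have "\<dots> = real c ^ card ?J * ?B"
      by (simp add: prod.distrib)
    finally have 1: "\<bar>\<phi> ?t\<bar> = 1 / (real ?t * ((real ?t - 1) * (real c ^ card ?J * ?B)))"
      by (simp add: \<phi>_def)
    have B: "?B > 0" by (intro prod_pos) auto
    have A: "?A \<le> 2 * ?B" using prod_square_ratio_le[of j m] j by simp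
    have t1: "real ?t - 1 \<ge> (real c - 1) * real j^2" using j by (simp add: algebra_simps)
    have cj: "(real c - 1) * real j^2 > 0" using assms(1) j by simp
    have "\<bar>a ?t\<bar> = \<bar>\<phi> ?t\<bar> / \<bar>\<phi> 0\<bar>" using tP by (simp add: a_def S_def)
    also have "\<dots> = (?A / ?B) / (real ?t - 1)"
      unfolding 0 1 using assms(1) j by (simp add: divide_simps)
    also have "\<dots> \<le> 2 / ((real c - 1) * real j^2)"
      using t1 cj A B by (intro frac_le) (auto simp: divide_simps)
    finally show ?thesis .
  qed
  have "(\<Sum>t\<in>{2..N}. \<bar>a t\<bar>) = (\<Sum>t\<in>P. \<bar>a t\<bar>)"
    using SN P2 by (intro sum.mono_neutral_right) (auto simp: a_def S_def)
  also have "\<dots> = (\<Sum>j\<in>{1..m}. \<bar>a (c * j^2)\<bar>)"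
    by (simp add: P_def sum.reindex[OF inj])
  also have "\<dots> \<le> (\<Sum>j\<in>{1..m}. 2 / (real c - 1) * (1 / real j^2))"
    by (intro sum_mono order.trans[OF bound]) auto
  also have "\<dots> = 2 / (real c - 1) * (\<Sum>j\<in>{1..m}. 1 / real j^2)"
    by (simp only: sum_distrib_left)
  also have "\<dots> \<le> 2 / (real c - 1) * 2"
    using assms(1) by (intro mult_left_mono order.trans[OF sum_inverse_squares_le]) auto
  finally have "(\<Sum>t\<in>{2..N}. \<bar>a t\<bar>) \<le> 4 / (real c - 1)" by simp
  moreover have "a 0 = 1" using \<phi>0 by (simp add: a_def S_def)
  ultimately show ?thesis using mom by blast
qed

text \<open>\<open>u\<close> and \<open>v\<close> are the positive and negative parts of the signed
  weights, which have equal mass \<open>W\<close> because the moment of order 0 vanishes.\<close>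

lemma ex_moment_matching_pair:
  fixes \<eta> :: real
  assumes "0 < \<eta>" "\<eta> < 1" "1 \<le> N" "2 \<le> c" "4 / (real c - 1) \<le> \<eta>" "c * m^2 \<le> N"
  shows "\<exists>u v :: nat \<Rightarrow> real. (\<forall>t. 0 \<le> u t) \<and> (\<forall>t. 0 \<le> v t) \<and>
    (\<Sum>t\<le>N. u t) = 1 \<and> (\<Sum>t\<le>N. v t) = 1 \<and> 1 - \<eta> \<le> u 0 \<and> v 0 = 0 \<and>
    (\<forall>r\<le>m. (\<Sum>t\<le>N. u t * real (t choose r)) = (\<Sum>t\<le>N. v t * real (t choose r)))"
proof -
  obtain a where a: "a 0 = 1" "(\<Sum>t\<in>{2..N}. \<bar>a t\<bar>) \<le> \<eta>"
    "\<And>r. r \<le> m \<Longrightarrow> (\<Sum>t\<le>N. a t * real (t choose r)) = 0"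
    using ex_signed_weights[of c N m] assms by (meson order.trans)
  define W where "W = (\<Sum>t\<le>N. max 0 (a t))"
  have split: "(\<Sum>t\<le>N. f t) = f 0 + f 1 + (\<Sum>t\<in>{2..N}. f t)" for f :: "nat \<Rightarrow> real"
  proof -
    have "{..N} = insert 0 (insert 1 {2..N})" using assms(3) by auto
    then show ?thesis by simp
  qed
  have diff: "(\<Sum>t\<le>N. max 0 (a t) * f t) - (\<Sum>t\<le>N. max 0 (- a t) * f t) = (\<Sum>t\<le>N. a t * f t)" for f
    unfolding sum_subtractf[symmetric] by (intro sum.cong) (auto simp: max_def algebra_simps)
  have "\<bar>\<Sum>t\<in>{2..N}. a t\<bar> \<le> \<eta>" using a(2) sum_abs order.trans by blast
  \<comment> \<open>Total mass 0 forces \<open>a 1 \<le> -1 + \<eta>\<close>. So the node 1 adds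
    nothing to the positive part, whose mass exceeds \<open>a 0 = 1\<close> by at most
    \<open>\<eta>\<close>.\<close>
  then have a1: "a 1 < 0" using a(3)[of 0] split[of a] a(1) assms(2) by simp
  have "W = 1 + (\<Sum>t\<in>{2..N}. max 0 (a t))"
    using a1 a(1) by (simp add: W_def split)
  moreover have "(\<Sum>t\<in>{2..N}. max 0 (a t)) \<le> (\<Sum>t\<in>{2..N}. \<bar>a t\<bar>)" "0 \<le> (\<Sum>t\<in>{2..N}. max 0 (a t))"
    by (auto intro!: sum_mono sum_nonneg)
  ultimately have W: "1 \<le> W" "W \<le> 1 + \<eta>" using a(2) by auto
  have W': "(\<Sum>t\<le>N. max 0 (- a t)) = W" using diff[of "\<lambda>_. 1"] a(3)[of 0] by (simp add: W_def)
  define u where "u = (\<lambda>t. max 0 (a t) / W)"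
  define v where "v = (\<lambda>t. max 0 (- a t) / W)"
  have "(1 - \<eta>) * W \<le> (1 - \<eta>) * (1 + \<eta>)" using W assms(2) by (intro mult_left_mono) auto
  also have "\<dots> \<le> 1" by (simp add: algebra_simps)
  finally have "1 - \<eta> \<le> u 0" using W a(1) by (simp add: u_def le_divide_eq)
  moreover have "(\<Sum>t\<le>N. u t * real (t choose r)) = (\<Sum>t\<le>N. v t * real (t choose r))" if "r \<le> m" for r
    using diff[of "\<lambda>t. real (t choose r)"] a(3)[OF that]
    by (simp add: u_def v_def flip: sum_divide_distrib)
  moreover have "(\<Sum>t\<le>N. u t) = 1" "(\<Sum>t\<le>N. v t) = 1"
    using W W' by (simp_all add: u_def v_def W_def flip: sum_divide_distrib)
  moreover have "0 \<le> u t" "0 \<le> v t" for t using W by (auto simp: u_def v_def)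
  moreover have "v 0 = 0" using a(1) by (simp add: v_def)
  ultimately show ?thesis by blast
qed

section \<open>Distributions on subsets that depend only on the size\<close>

definition subset_weight :: "(nat \<Rightarrow> real) \<Rightarrow> nat \<Rightarrow> 'a set \<Rightarrow> real" where
  "subset_weight b n X = b (card X) / real (n choose card X)"

lemma card_supersets_of_card:
  assumes "finite B" "H \<subseteq> B" "card H \<le> t"
  shows "card {X. H \<subseteq> X \<and> X \<subseteq> B \<and> card X = t} = (card B - card H) choose (t - card H)"
proof -
  have fH: "finite H" using assms finite_subset by blast
  have "bij_betw (\<lambda>Y. Y \<union> H) {Y. Y \<subseteq> B - H \<and> card Y = t - card H} {X. H \<subseteq> X \<and> X \<subseteq> B \<and> card X = t}"
  proof (rule bij_betw_byWitness[where f' = "\<lambda>X. X - H"])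
    show "(\<lambda>Y. Y \<union> H) ` {Y. Y \<subseteq> B - H \<and> card Y = t - card H} \<subseteq> {X. H \<subseteq> X \<and> X \<subseteq> B \<and> card X = t}"
    proof clarify
      fix Y assume Y: "Y \<subseteq> B - H" "card Y = t - card H"
      then have "card (Y \<union> H) = card Y + card H"
        using assms fH by (intro card_Un_disjoint) (auto intro: finite_subset)
      then show "H \<subseteq> Y \<union> H \<and> Y \<union> H \<subseteq> B \<and> card (Y \<union> H) = t" using Y assms by auto
    qed
    show "(\<lambda>X. X - H) ` {X. H \<subseteq> X \<and> X \<subseteq> B \<and> card X = t} \<subseteq> {Y. Y \<subseteq> B - H \<and> card Y = t - card H}"
      using fH by (auto simp: card_Diff_subset)
  qed auto
  then have "card {X. H \<subseteq> X \<and> X \<subseteq> B \<and> card X = t} = card {Y. Y \<subseteq> B - H \<and> card Y = t - card H}"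
    by (rule bij_betw_same_card[symmetric])
  also have "\<dots> = card (B - H) choose (t - card H)"
    using assms by (intro n_subsets) auto
  finally show ?thesis using fH assms by (simp add: card_Diff_subset)
qed

text \<open>With \<open>h = card H\<close>, the fraction of \<open>t\<close>-subsets that contain
  \<open>H\<close> is \<open>(n - h choose (t - h)) / (n choose t) = (t choose h) / (n choose
  h)\<close>. Hence matching binomial moments make small sets \<open>H\<close> equally likely to be
  covered.\<close>

lemma sum_subset_weight_supersets:
  assumes "finite B" "card B = n" "H \<subseteq> B"
  shows "(\<Sum>X\<in>Pow B. subset_weight b n X * of_bool (H \<subseteq> X)) =
    (\<Sum>t\<le>n. b t * real (t choose card H)) / real (n choose card H)"
proof -
  have Hn: "card H \<le> n" using assms card_mono by blast
  have inner: "(\<Sum>X\<in>{X\<in>Pow B. card X = t}. subset_weight b n X * of_bool (H \<subseteq> X)) =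
      b t * real (t choose card H) / real (n choose card H)" if "t \<le> n" for t
  proof -
    have "(\<Sum>X\<in>{X\<in>Pow B. card X = t}. subset_weight b n X * of_bool (H \<subseteq> X)) =
        (\<Sum>X\<in>{X. H \<subseteq> X \<and> X \<subseteq> B \<and> card X = t}. b t / real (n choose t))"
      using assms(1) by (intro sum.mono_neutral_cong_right) (auto simp: subset_weight_def)
    also have "\<dots> = b t * real (card {X. H \<subseteq> X \<and> X \<subseteq> B \<and> card X = t}) / real (n choose t)"
      by simp
    also have "\<dots> = b t * real (t choose card H) / real (n choose card H)"
    proof (cases "card H \<le> t")
      case True
      have "real (n choose t) * real (t choose card H) =
          real (n choose card H) * real ((n - card H) choose (t - card H))"
        unfolding of_nat_mult[symmetric] using choose_mult[OF True that] by simp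
      then show ?thesis
        using card_supersets_of_card[OF assms(1,3) True] assms(2) Hn that by (simp add: field_simps)
    next
      case False
      have "X \<notin> {X. H \<subseteq> X \<and> X \<subseteq> B \<and> card X = t}" for X
        using False assms(1) by (auto dest: card_mono[OF finite_subset[of _ B]])
      then have "{X. H \<subseteq> X \<and> X \<subseteq> B \<and> card X = t} = {}" by blast
      then show ?thesis using False by (simp only: card.empty) simp
    qed
    finally show ?thesis .
  qed
  have "(\<Sum>X\<in>Pow B. subset_weight b n X * of_bool (H \<subseteq> X)) =
      (\<Sum>t\<le>n. \<Sum>X\<in>{X\<in>Pow B. card X = t}. subset_weight b n X * of_bool (H \<subseteq> X))"
    using assms by (intro sum.group[symmetric]) (auto intro: card_mono)
  also have "\<dots> = (\<Sum>t\<le>n. b t * real (t choose card H) / real (n choose card H))"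
    using inner by (intro sum.cong) auto
  finally show ?thesis by (simp add: sum_divide_distrib)
qed

lemma sum_subset_weight:
  assumes "finite B" "card B = n"
  shows "(\<Sum>X\<in>Pow B. subset_weight b n X) = (\<Sum>t\<le>n. b t)"
  using sum_subset_weight_supersets[OF assms, of "{}" b] by simp

text \<open>A product over all blocks in which only the factors in \<open>G\<close> depend on \<open>Z\<close> is a combination of
  the indicators of \<open>H \<subseteq> Z\<close> with \<open>H \<subseteq> G\<close>.\<close>
lemma sum_prod_if_eq:
  fixes P Q :: "'a set \<Rightarrow> real" and \<alpha> \<beta> :: "'a \<Rightarrow> real"
  assumes "finite I" "G \<subseteq> I" "\<And>i. i \<in> I - G \<Longrightarrow> \<alpha> i = \<beta> i"
    and eq: "\<And>H. H \<subseteq> G \<Longrightarrow> (\<Sum>Z\<in>Pow I. P Z * of_bool (H \<subseteq> Z)) = (\<Sum>Z\<in>Pow I. Q Z * of_bool (H \<subseteq> Z))"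
  shows "(\<Sum>Z\<in>Pow I. P Z * (\<Prod>i\<in>I. if i \<in> Z then \<alpha> i else \<beta> i)) =
         (\<Sum>Z\<in>Pow I. Q Z * (\<Prod>i\<in>I. if i \<in> Z then \<alpha> i else \<beta> i))"
proof -
  have fG: "finite G" using assms finite_subset by blast
  define K where "K = (\<lambda>H. (\<Prod>i\<in>I - G. \<beta> i) * ((\<Prod>i\<in>H. \<alpha> i - \<beta> i) * (\<Prod>i\<in>G - H. \<beta> i)))"
  have expand: "(\<Prod>i\<in>I. if i \<in> Z then \<alpha> i else \<beta> i) = (\<Sum>H\<in>Pow G. K H * of_bool (H \<subseteq> Z))" for Z
  proof -
    have "(\<Prod>i\<in>I. if i \<in> Z then \<alpha> i else \<beta> i) =
        (\<Prod>i\<in>I - G. if i \<in> Z then \<alpha> i else \<beta> i) * (\<Prod>i\<in>G. if i \<in> Z then \<alpha> i else \<beta> i)"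
      using assms by (intro prod.subset_diff) auto
    also have "(\<Prod>i\<in>I - G. if i \<in> Z then \<alpha> i else \<beta> i) = (\<Prod>i\<in>I - G. \<beta> i)"
      using assms by (intro prod.cong) auto
    \<comment> \<open>Writing the choice as an indicator times \<open>\<alpha> i - \<beta> i\<close>
      plus \<open>\<beta> i\<close> lets the product expand over the subsets \<open>H\<close> of
      \<open>G\<close>.\<close>
    also have "(\<Prod>i\<in>G. if i \<in> Z then \<alpha> i else \<beta> i) = (\<Prod>i\<in>G. of_bool (i \<in> Z) * (\<alpha> i - \<beta> i) + \<beta> i)"
      by (intro prod.cong) auto
    also have "\<dots> = (\<Sum>H\<in>Pow G. (\<Prod>i\<in>H. of_bool (i \<in> Z) * (\<alpha> i - \<beta> i)) * (\<Prod>i\<in>G - H. \<beta> i))"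
      by (rule prod_add[OF fG])
    also have "\<dots> = (\<Sum>H\<in>Pow G. of_bool (H \<subseteq> Z) * ((\<Prod>i\<in>H. \<alpha> i - \<beta> i) * (\<Prod>i\<in>G - H. \<beta> i)))"
    proof (intro sum.cong refl)
      fix H assume "H \<in> Pow G"
      then have "finite H" using fG finite_subset by blast
      then have "(\<Prod>i\<in>H. of_bool (i \<in> Z)) = (of_bool (H \<subseteq> Z) :: real)"
        by (induction H) auto
      then show "(\<Prod>i\<in>H. of_bool (i \<in> Z) * (\<alpha> i - \<beta> i)) * (\<Prod>i\<in>G - H. \<beta> i) =
          of_bool (H \<subseteq> Z) * ((\<Prod>i\<in>H. \<alpha> i - \<beta> i) * (\<Prod>i\<in>G - H. \<beta> i))"
        by (simp add: prod.distrib)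
    qed
    finally show ?thesis by (simp add: K_def sum_distrib_left mult_ac)
  qed
  have swap: "(\<Sum>Z\<in>Pow I. R Z * (\<Prod>i\<in>I. if i \<in> Z then \<alpha> i else \<beta> i)) =
      (\<Sum>H\<in>Pow G. K H * (\<Sum>Z\<in>Pow I. R Z * of_bool (H \<subseteq> Z)))" for R
    unfolding expand sum_distrib_left by (subst sum.swap) (simp add: mult_ac)
  show ?thesis unfolding swap using eq by (intro sum.cong) auto
qed

section \<open>Averages over independent blocks\<close>

text \<open>This is the \<open>q Z\<close> of the overview for a general \<open>f\<close>.
  Extensional functions keep the sample space finite, so the expectation is a plain sum.\<close>

definition block_average ::
    "(nat \<Rightarrow> real) \<Rightarrow> (nat \<Rightarrow> real) \<Rightarrow> nat \<Rightarrow> 'i set \<Rightarrow> ('i \<Rightarrow> 'a set) \<Rightarrow> ('a set \<Rightarrow> real) \<Rightarrow> 'i set \<Rightarrow> real" where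
  "block_average u v n I B f Z =
     (\<Sum>X\<in>(\<Pi>\<^sub>E i\<in>I. Pow (B i)).
        (\<Prod>i\<in>I. subset_weight (if i \<in> Z then u else v) n (X i)) * f (\<Union>i\<in>I. X i))"

lemma block_average_sum:
  "block_average u v n I B (\<lambda>Y. \<Sum>m\<in>M. c m * g m Y) Z = (\<Sum>m\<in>M. c m * block_average u v n I B (g m) Z)"
  unfolding block_average_def sum_distrib_left by (subst sum.swap) (simp add: mult_ac)

lemma block_average_add:
  "block_average u v n I B (\<lambda>Y. f Y + g Y) Z = block_average u v n I B f Z + block_average u v n I B g Z"
  by (simp add: block_average_def distrib_left sum.distrib)

text \<open>Independence of the blocks: the expectation of a product of per-block quantities
  factors, by distributivity.\<close>

lemma block_average_prod:
  assumes "finite I" "\<And>i. i \<in> I \<Longrightarrow> finite (B i)"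
    and "\<And>X. X \<in> (\<Pi>\<^sub>E i\<in>I. Pow (B i)) \<Longrightarrow> f (\<Union>i\<in>I. X i) = (\<Prod>i\<in>I. h i (X i))"
  shows "block_average u v n I B f Z =
    (\<Prod>i\<in>I. if i \<in> Z then \<Sum>X\<in>Pow (B i). subset_weight u n X * h i X
             else \<Sum>X\<in>Pow (B i). subset_weight v n X * h i X)"
proof -
  have "block_average u v n I B f Z =
      (\<Sum>X\<in>(\<Pi>\<^sub>E i\<in>I. Pow (B i)). \<Prod>i\<in>I. subset_weight (if i \<in> Z then u else v) n (X i) * h i (X i))"
    unfolding block_average_def by (intro sum.cong) (simp_all add: assms(3) prod.distrib)
  also have "\<dots> = (\<Prod>i\<in>I. \<Sum>X\<in>Pow (B i). subset_weight (if i \<in> Z then u else v) n X * h i X)"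
    using assms by (intro prod_sum_PiE[symmetric]) auto
  also have "\<dots> = (\<Prod>i\<in>I. if i \<in> Z then \<Sum>X\<in>Pow (B i). subset_weight u n X * h i X
             else \<Sum>X\<in>Pow (B i). subset_weight v n X * h i X)"
    by (intro prod.cong) auto
  finally show ?thesis .
qed

lemma UN_PiE_Int_block:
  assumes "disjoint_family_on B I" "X \<in> (\<Pi>\<^sub>E i\<in>I. Pow (B i))" "k \<in> I"
  shows "(\<Union>i\<in>I. X i) \<inter> B k = X k"
proof (intro equalityI subsetI)
  fix a assume "a \<in> (\<Union>i\<in>I. X i) \<inter> B k"
  then obtain i where i: "i \<in> I" "a \<in> X i" "a \<in> B k" by auto
  then have "a \<in> B i" using assms(2) by (auto simp: PiE_iff)
  then have "i = k" using i assms(1,3) by (auto simp: disjoint_family_on_def)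
  then show "a \<in> X k" using i by simp
next
  fix a assume "a \<in> X k"
  then show "a \<in> (\<Union>i\<in>I. X i) \<inter> B k" using assms(2,3) by (auto simp: PiE_iff)
qed

lemma of_bool_subset_UN:
  assumes "finite I" "disjoint_family_on B I" "A \<subseteq> (\<Union>i\<in>I. B i)" "X \<in> (\<Pi>\<^sub>E i\<in>I. Pow (B i))"
  shows "of_bool (A \<subseteq> (\<Union>i\<in>I. X i)) = (\<Prod>i\<in>I. of_bool (A \<inter> B i \<subseteq> X i) :: real)"
proof -
  have "A \<subseteq> (\<Union>i\<in>I. X i) \<longleftrightarrow> (\<forall>i\<in>I. A \<inter> B i \<subseteq> X i)"
  proof
    assume "A \<subseteq> (\<Union>i\<in>I. X i)"
    then show "\<forall>i\<in>I. A \<inter> B i \<subseteq> X i" using UN_PiE_Int_block[OF assms(2,4)] by blast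
  next
    assume L: "\<forall>i\<in>I. A \<inter> B i \<subseteq> X i"
    show "A \<subseteq> (\<Union>i\<in>I. X i)"
    proof
      fix a assume a: "a \<in> A"
      then obtain i where "i \<in> I" "a \<in> B i" using assms(3) by auto
      then show "a \<in> (\<Union>i\<in>I. X i)" using a L by auto
    qed
  qed
  moreover have "(\<Prod>i\<in>I. of_bool (A \<inter> B i \<subseteq> X i) :: real) = of_bool (\<forall>i\<in>I. A \<inter> B i \<subseteq> X i)"
    using assms(1) by (induction I) auto
  ultimately show ?thesis by simp
qed

section \<open>The degree bound for abstract blocks\<close>

context
  fixes u v :: "nat \<Rightarrow> real" and n d :: nat and I :: "'i set" and B :: "'i \<Rightarrow> 'a set"
  assumes I: "finite I" "card I = n"
    and B: "\<And>i. i \<in> I \<Longrightarrow> finite (B i)" "\<And>i. i \<in> I \<Longrightarrow> card (B i) = n" "disjoint_family_on B I"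
    and nonneg: "\<And>t. 0 \<le> u t" "\<And>t. 0 \<le> v t"
    and total: "(\<Sum>t\<le>n. u t) = 1" "(\<Sum>t\<le>n. v t) = 1"
    and moments: "\<And>r. r \<le> d \<Longrightarrow> (\<Sum>t\<le>n. u t * real (t choose r)) = (\<Sum>t\<le>n. v t * real (t choose r))"
begin

lemma moments_subset:
  assumes "finite C" "card C = n" "H \<subseteq> C" "card H \<le> d"
  shows "(\<Sum>X\<in>Pow C. subset_weight u n X * of_bool (H \<subseteq> X)) =
         (\<Sum>X\<in>Pow C. subset_weight v n X * of_bool (H \<subseteq> X))"
  using sum_subset_weight_supersets[OF assms(1-3)] moments[OF assms(4)] by simp

text \<open>Moment matching acts twice: inside a block outside \<open>G\<close> it makes the factor
  independent of the bit \<open>i \<in> Z\<close>, and on the law of \<open>Z\<close> it equates the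
  probabilities of covering subsets of \<open>G\<close>. Disjointness of the blocks gives
  \<open>card G * (d + 1) \<le> card A\<close>, whence \<open>card G \<le> d\<close>.\<close>

lemma block_average_monomial_match:
  assumes A: "A \<subseteq> (\<Union>i\<in>I. B i)" "card A < (d + 1)^2"
  shows "(\<Sum>Z\<in>Pow I. subset_weight u n Z * block_average u v n I B (\<lambda>Y. of_bool (A \<subseteq> Y)) Z) =
         (\<Sum>Z\<in>Pow I. subset_weight v n Z * block_average u v n I B (\<lambda>Y. of_bool (A \<subseteq> Y)) Z)"
proof -
  define G where "G = {i\<in>I. d + 1 \<le> card (A \<inter> B i)}"
  have fA: "finite A" using A(1) I B finite_subset[of A "\<Union>i\<in>I. B i"] by blast
  have "finite G" using I by (simp add: G_def)
  have "card G * (d + 1) = (\<Sum>i\<in>G. d + 1)" by simp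
  also have "\<dots> \<le> (\<Sum>i\<in>G. card (A \<inter> B i))" by (intro sum_mono) (simp add: G_def)
  also have "\<dots> = card (\<Union>i\<in>G. A \<inter> B i)"
    using fA B(3) \<open>finite G\<close>
    by (intro card_UN_disjoint[symmetric]) (auto simp: G_def disjoint_family_on_def)
  also have "\<dots> \<le> card A" using fA by (intro card_mono) auto
  also have "\<dots> < (d + 1) * (d + 1)" using A(2) by (simp add: power2_eq_square)
  finally have G: "card G \<le> d" unfolding mult_less_cancel2 by simp
  have avg: "block_average u v n I B (\<lambda>Y. of_bool (A \<subseteq> Y)) Z =
     (\<Prod>i\<in>I. if i \<in> Z then \<Sum>X\<in>Pow (B i). subset_weight u n X * of_bool (A \<inter> B i \<subseteq> X)
             else \<Sum>X\<in>Pow (B i). subset_weight v n X * of_bool (A \<inter> B i \<subseteq> X))" for Z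
    using I B A by (intro block_average_prod of_bool_subset_UN) auto
  show ?thesis unfolding avg
  proof (rule sum_prod_if_eq[where G = G])
    show "(\<Sum>X\<in>Pow (B i). subset_weight u n X * of_bool (A \<inter> B i \<subseteq> X)) =
          (\<Sum>X\<in>Pow (B i). subset_weight v n X * of_bool (A \<inter> B i \<subseteq> X))" if "i \<in> I - G" for i
      using that B by (intro moments_subset) (auto simp: G_def)
    show "(\<Sum>Z\<in>Pow I. subset_weight u n Z * of_bool (H \<subseteq> Z)) =
          (\<Sum>Z\<in>Pow I. subset_weight v n Z * of_bool (H \<subseteq> Z))" if "H \<subseteq> G" for H
      using that I G card_mono[OF \<open>finite G\<close> that] by (intro moments_subset) (auto simp: G_def)
  qed (use I in \<open>auto simp: G_def\<close>)
qed

lemma block_average_const: "block_average u v n I B (\<lambda>_. c) Z = c"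
proof -
  have "block_average u v n I B (\<lambda>_. 1) Z = 1"
    using I B total by (subst block_average_prod[where h = "\<lambda>_ _. 1"])
      (auto simp: sum_subset_weight intro!: prod.neutral)
  then show ?thesis by (simp add: block_average_def flip: sum_distrib_right)
qed

text \<open>The comparison is only required on inputs of nonzero weight; this is where
  \<open>v 0 = 0\<close> can rule out empty blocks.\<close>

lemma block_average_mono:
  assumes "\<And>X. X \<in> (\<Pi>\<^sub>E i\<in>I. Pow (B i)) \<Longrightarrow>
      (\<And>i. i \<in> I \<Longrightarrow> subset_weight (if i \<in> Z then u else v) n (X i) \<noteq> 0) \<Longrightarrow> f (\<Union>i\<in>I. X i) \<le> g (\<Union>i\<in>I. X i)"
  shows "block_average u v n I B f Z \<le> block_average u v n I B g Z"
  unfolding block_average_def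
proof (intro sum_mono)
  fix X assume X: "X \<in> (\<Pi>\<^sub>E i\<in>I. Pow (B i))"
  let ?w = "\<Prod>i\<in>I. subset_weight (if i \<in> Z then u else v) n (X i)"
  show "?w * f (\<Union>i\<in>I. X i) \<le> ?w * g (\<Union>i\<in>I. X i)"
  proof (cases "?w = 0")
    case False
    then have "subset_weight (if i \<in> Z then u else v) n (X i) \<noteq> 0" if "i \<in> I" for i
      using that I(1) by (metis (no_types, lifting) prod_zero_iff)
    moreover have "0 \<le> ?w" using nonneg by (intro prod_nonneg) (auto simp: subset_weight_def)
    ultimately show ?thesis using assms[OF X] by (intro mult_left_mono) auto
  qed simp
qed

lemma block_average_block_nonempty:
  assumes "k \<in> I" "k \<in> Z"
  shows "block_average u v n I B (\<lambda>Y. of_bool (Y \<inter> B k \<noteq> {})) Z = 1 - u 0"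
proof -
  have k: "(\<Union>i\<in>I. X i) \<inter> B k = X k" if "X \<in> (\<Pi>\<^sub>E i\<in>I. Pow (B i))" for X
    using UN_PiE_Int_block[OF B(3) that assms(1)] .
  have "block_average u v n I B (\<lambda>Y. of_bool (Y \<inter> B k \<noteq> {})) Z =
     (\<Prod>i\<in>I. if i \<in> Z then \<Sum>X\<in>Pow (B i). subset_weight u n X * (if i = k then of_bool (X \<noteq> {}) else 1)
             else \<Sum>X\<in>Pow (B i). subset_weight v n X * (if i = k then of_bool (X \<noteq> {}) else 1))"
    using I B assms k by (intro block_average_prod) auto
  also have "\<dots> = (\<Prod>i\<in>I. if i = k then \<Sum>X\<in>Pow (B k). subset_weight u n X * of_bool (X \<noteq> {}) else 1)"
    using assms I B total by (intro prod.cong) (auto simp: sum_subset_weight)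
  also have "\<dots> = (\<Sum>X\<in>Pow (B k). subset_weight u n X * of_bool (X \<noteq> {}))"
    using assms(1) I by simp
  also have "\<dots> = (\<Sum>X\<in>Pow (B k) - {{}}. subset_weight u n X)"
    using B(1)[OF assms(1)] by (intro sum.mono_neutral_cong_right) auto
  also have "\<dots> = (\<Sum>X\<in>Pow (B k). subset_weight u n X) - subset_weight u n ({} :: 'a set)"
    using B(1)[OF assms(1)] by (simp add: sum_diff1)
  also have "\<dots> = 1 - u 0"
    using B assms(1) total by (simp add: sum_subset_weight) (simp add: subset_weight_def)
  finally show ?thesis .
qed

lemma and_or_degree_bound:
  assumes u0: "1 - \<eta> \<le> u 0" and v0: "v 0 = 0" and \<epsilon>: "\<eta> \<le> 1" "0 \<le> \<epsilon>" "\<epsilon> \<le> 1" "\<epsilon> + \<eta> < (1 - \<eta>) * (1 - \<epsilon>)"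
    and f: "\<And>Y. f Y = (\<Sum>m\<in>M. c m * of_bool (\<kappa> m \<subseteq> Y))"
    and vars: "\<And>m. m \<in> M \<Longrightarrow> \<kappa> m \<subseteq> (\<Union>i\<in>I. B i)"
    and f1: "\<And>Y. (\<forall>i\<in>I. Y \<inter> B i \<noteq> {}) \<Longrightarrow> 1 - \<epsilon> \<le> f Y \<and> f Y \<le> 1"
    and f0: "\<And>Y. \<not> (\<forall>i\<in>I. Y \<inter> B i \<noteq> {}) \<Longrightarrow> 0 \<le> f Y \<and> f Y \<le> \<epsilon>"
  shows "\<exists>m\<in>M. (d + 1)^2 \<le> card (\<kappa> m)"
proof (rule ccontr)
  assume "\<not> ?thesis"
  then have deg: "\<And>m. m \<in> M \<Longrightarrow> card (\<kappa> m) < (d + 1)^2" by force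
  let ?E = "block_average u v n I B"
  define q where "q = ?E f"
  have f': "f = (\<lambda>Y. \<Sum>m\<in>M. c m * of_bool (\<kappa> m \<subseteq> Y))" using f by blast
  have swap: "(\<Sum>Z\<in>Pow I. subset_weight b n Z * q Z) =
    (\<Sum>m\<in>M. c m * (\<Sum>Z\<in>Pow I. subset_weight b n Z * ?E (\<lambda>Y. of_bool (\<kappa> m \<subseteq> Y)) Z))" for b
    unfolding q_def f' block_average_sum sum_distrib_left by (subst sum.swap) (simp add: mult_ac)
  have match: "(\<Sum>Z\<in>Pow I. subset_weight u n Z * q Z) = (\<Sum>Z\<in>Pow I. subset_weight v n Z * q Z)"
    unfolding swap using block_average_monomial_match[OF vars deg] by (intro sum.cong) auto
  have f_nonneg: "0 \<le> f Y" for Y using f0[of Y] f1[of Y] \<epsilon> by (smt (verit) mult_nonneg_nonneg mult_nonneg_nonpos)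
  have q_nonneg: "0 \<le> q Z" for Z
    using block_average_mono[of Z "\<lambda>_. 0" f] f_nonneg by (simp add: q_def block_average_const)
  have "?E (\<lambda>_. 1 - \<epsilon>) {} \<le> ?E f {}"
  proof (rule block_average_mono)
    fix X assume PX: "X \<in> (\<Pi>\<^sub>E i\<in>I. Pow (B i))"
      and "\<And>i. i \<in> I \<Longrightarrow> subset_weight (if i \<in> {} then u else v) n (X i) \<noteq> 0"
    then have "X i \<noteq> {}" if "i \<in> I" for i using that v0 by (force simp: subset_weight_def)
    then show "1 - \<epsilon> \<le> f (\<Union>i\<in>I. X i)" using f1 UN_PiE_Int_block[OF B(3) PX] by simp
  qed
  then have q_empty: "1 - \<epsilon> \<le> q {}" by (simp add: q_def block_average_const)
  have q_le: "q Z \<le> \<epsilon> + \<eta>" if Z: "Z \<subseteq> I" "Z \<noteq> {}" for Z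
  proof -
    obtain k where k: "k \<in> Z" "k \<in> I" using Z by auto
    \<comment> \<open>An empty block \<open>k\<close> makes the tree false, so
      \<open>f Y \<le> \<epsilon>\<close>; otherwise \<open>f Y \<le> 1\<close> suffices.\<close>
    have "f Y \<le> \<epsilon> + of_bool (Y \<inter> B k \<noteq> {})" for Y
      using f0[of Y] f1[of Y] k \<epsilon>(2) by (cases "Y \<inter> B k = {}"; cases "\<forall>i\<in>I. Y \<inter> B i \<noteq> {}") auto
    then have "q Z \<le> ?E (\<lambda>Y. \<epsilon> + of_bool (Y \<inter> B k \<noteq> {})) Z"
      unfolding q_def by (intro block_average_mono)
    also have "\<dots> = \<epsilon> + (1 - u 0)"
      unfolding block_average_add block_average_const
        block_average_block_nonempty[OF k(2,1)] by (rule refl)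
    finally show ?thesis using u0 by simp
  qed
  have w_nonneg: "0 \<le> subset_weight b n Z" if "\<And>t. 0 \<le> b t" for b and Z :: "'i set"
    using that by (simp add: subset_weight_def)
  \<comment> \<open>Under \<open>u\<close> the single term \<open>Z = {}\<close> already gives the
    lower bound, the other terms being nonnegative. Under \<open>v\<close> that term has weight 0,
    so \<open>q_le\<close> covers all the rest.\<close>
  have "(1 - \<eta>) * (1 - \<epsilon>) \<le> u 0 * q {}"
    using u0 q_empty \<epsilon> nonneg by (intro mult_mono) auto
  also have "\<dots> = (\<Sum>Z\<in>{{}}. subset_weight u n Z * q Z)" by (simp add: subset_weight_def)
  also have "\<dots> \<le> (\<Sum>Z\<in>Pow I. subset_weight u n Z * q Z)"
    using I q_nonneg w_nonneg nonneg by (intro sum_mono2) auto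
  also have "\<dots> = (\<Sum>Z\<in>Pow I. subset_weight v n Z * q Z)" by (rule match)
  also have "\<dots> \<le> (\<Sum>Z\<in>Pow I. subset_weight v n Z * (\<epsilon> + \<eta>))"
  proof (intro sum_mono)
    fix Z assume "Z \<in> Pow I"
    then show "subset_weight v n Z * q Z \<le> subset_weight v n Z * (\<epsilon> + \<eta>)"
      using q_le[of Z] w_nonneg[of v Z] nonneg v0
      by (cases "Z = {}") (auto simp: subset_weight_def intro!: mult_left_mono divide_right_mono)
  qed
  also have "\<dots> = \<epsilon> + \<eta>"
    using I total by (simp add: sum_subset_weight flip: sum_distrib_right)
  finally show False using \<epsilon> by simp
qed

end

section \<open>Transfer to polynomials and the AND-OR tree\<close>

text \<open>Exponents on the keys are positive and 0 and 1 are idempotent, so on the cube a monomial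
  acts through its set of variables alone.\<close>

lemma mpoly_eval_of_bool:
  "mpoly_eval (\<lambda>i. of_bool (i \<in> Y)) p =
     (\<Sum>m\<in>Poly_Mapping.keys p. Poly_Mapping.lookup p m * of_bool (Poly_Mapping.keys m \<subseteq> Y))"
proof -
  have "(\<Prod>i\<in>Poly_Mapping.keys m. of_bool (i \<in> Y) ^ Poly_Mapping.lookup m i) =
      (of_bool (Poly_Mapping.keys m \<subseteq> Y) :: real)" for m :: monomial
  proof (cases "Poly_Mapping.keys m \<subseteq> Y")
    case False
    then obtain i where "i \<in> Poly_Mapping.keys m" "i \<notin> Y" by blast
    then show ?thesis using False
      by (auto simp: prod_zero_iff in_keys_iff intro!: bexI[of _ i])
  next
    case True
    then show ?thesis by (auto intro!: prod.neutral)
  qed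
  then show ?thesis by (simp add: mpoly_eval_def)
qed

lemma card_keys_le_mpoly_degree:
  assumes "m \<in> Poly_Mapping.keys p"
  shows "card (Poly_Mapping.keys m) \<le> mpoly_degree p"
proof -
  have "card (Poly_Mapping.keys m) = (\<Sum>i\<in>Poly_Mapping.keys m. 1)" by simp
  also have "\<dots> \<le> monomial_degree m"
    unfolding monomial_degree_def by (intro sum_mono) (simp add: in_keys_iff Suc_le_eq)
  also have "\<dots> \<le> mpoly_degree p"
    unfolding mpoly_degree_def using assms by (intro Max_ge) auto
  finally show ?thesis .
qed

abbreviation block :: "nat \<Rightarrow> nat \<Rightarrow> nat set" where
  "block N i \<equiv> {(i - 1) * N + 1..i * N}"

text \<open>Recovers the block from its element, which yields disjointness; the shifts by 1 come
  from counting variables and blocks from 1.\<close>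

lemma block_index:
  assumes "1 \<le> i" "j \<in> block N i"
  shows "(j - 1) div N = i - 1"
proof (rule div_nat_eqI)
  show "N * (i - 1) \<le> j - 1" using assms by (auto simp: mult.commute)
  have "j \<le> N + (i - 1) * N" "1 \<le> j" using assms by (cases i; auto)+
  then show "j - 1 < N * Suc (i - 1)" by (simp add: mult.commute)
qed

lemma disjoint_blocks: "disjoint_family_on (block N) {1..N}"
  unfolding disjoint_family_on_def
proof (intro ballI impI)
  fix i k assume "i \<in> {1..N}" "k \<in> {1..N}" "i \<noteq> k"
  then show "block N i \<inter> block N k = {}"
    using block_index[of i _ N] block_index[of k _ N] by fastforce
qed

lemma UN_blocks: "{1..N^2} \<subseteq> (\<Union>i\<in>{1..N}. block N i)"
proof
  fix j assume j: "j \<in> {1..N^2}"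
  then have "N > 0" by (cases N) auto
  define i where "i = (j - 1) div N + 1"
  have "j - 1 < N * N" using j by (auto simp: power2_eq_square)
  then have "i \<in> {1..N}" using \<open>N > 0\<close> by (simp add: i_def less_mult_imp_div_less Suc_le_eq)
  moreover have "(i - 1) * N \<le> j - 1" by (simp add: i_def)
  moreover have "j - 1 < i * N" using dividend_less_div_times[OF \<open>N > 0\<close>, of "j - 1"] by (simp add: i_def)
  ultimately show "j \<in> (\<Union>i\<in>{1..N}. block N i)" using j by (intro UN_I[of i]) auto
qed

lemma and_or_tree_mem:
  "and_or_tree N (\<lambda>i. i \<in> Y) \<longleftrightarrow> (\<forall>i\<in>{1..N}. Y \<inter> block N i \<noteq> {})"
  by (auto simp: and_or_tree_def)

lemma degree_ge_square:
  fixes \<epsilon> \<eta> :: real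
  assumes "0 \<le> \<epsilon>" "0 < \<eta>" "\<epsilon> + \<eta> < (1 - \<eta>) * (1 - \<epsilon>)" "\<epsilon> < 1" "\<eta> < 1"
    and "1 \<le> N" "2 \<le> c" "4 / (real c - 1) \<le> \<eta>" "c * d^2 \<le> N"
    and p: "mpoly_vars p \<subseteq> {1..N^2}" "approximates \<epsilon> p (and_or_tree N)"
  shows "(d + 1)^2 \<le> mpoly_degree p"
proof -
  obtain u v :: "nat \<Rightarrow> real" where uv: "\<And>t. 0 \<le> u t" "\<And>t. 0 \<le> v t"
    "(\<Sum>t\<le>N. u t) = 1" "(\<Sum>t\<le>N. v t) = 1" "1 - \<eta> \<le> u 0" "v 0 = 0"
    "\<And>r. r \<le> d \<Longrightarrow> (\<Sum>t\<le>N. u t * real (t choose r)) = (\<Sum>t\<le>N. v t * real (t choose r))"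
    using ex_moment_matching_pair[of \<eta> N c d] assms by blast
  define f where "f = (\<lambda>Y. mpoly_eval (\<lambda>i. of_bool (i \<in> Y)) p)"
  have "\<exists>m\<in>Poly_Mapping.keys p. (d + 1)^2 \<le> card (Poly_Mapping.keys m)"
  proof (rule and_or_degree_bound[where u = u and v = v and n = N and I = "{1..N}"
        and B = "block N" and f = f and \<epsilon> = \<epsilon> and \<eta> = \<eta>])
    show "card (block N i) = N" if "i \<in> {1..N}" for i using that by (cases i) auto
    show "f Y = (\<Sum>m\<in>Poly_Mapping.keys p. Poly_Mapping.lookup p m * of_bool (Poly_Mapping.keys m \<subseteq> Y))" for Y
      by (simp add: f_def mpoly_eval_of_bool)
    show "Poly_Mapping.keys m \<subseteq> (\<Union>i\<in>{1..N}. block N i)" if "m \<in> Poly_Mapping.keys p" for m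
      using that p(1) UN_blocks[of N] unfolding mpoly_vars_def by blast
    show "1 - \<epsilon> \<le> f Y \<and> f Y \<le> 1" if "\<forall>i\<in>{1..N}. Y \<inter> block N i \<noteq> {}" for Y
      using that p(2) unfolding approximates_def f_def and_or_tree_mem[symmetric] by (simp add: Let_def)
    show "0 \<le> f Y \<and> f Y \<le> \<epsilon>" if "\<not> (\<forall>i\<in>{1..N}. Y \<inter> block N i \<noteq> {})" for Y
      using that p(2) unfolding approximates_def f_def and_or_tree_mem[symmetric] by (simp add: Let_def)
  qed (use assms uv disjoint_blocks in auto)
  then show ?thesis using card_keys_le_mpoly_degree order.trans by blast
qed

theorem theorem3:
  fixes \<epsilon> :: real
  assumes "0 < \<epsilon>" and "\<epsilon> < 1/2"
  shows "\<exists>c::real. c > 0 \<and> (\<exists>N0::nat. \<forall>N\<ge>N0. \<forall>p::real_mpoly.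
           mpoly_vars p \<subseteq> {1..N^2} \<longrightarrow> approximates \<epsilon> p (and_or_tree N) \<longrightarrow>
             real (mpoly_degree p) \<ge> c * real N powr (2/3))"
proof -
  \<comment> \<open>Any positive value below \<open>(1 - 2 * \<epsilon>) / 2\<close> gives
    \<open>\<epsilon> + \<eta> < 1 - \<eta> - \<epsilon>\<close>.\<close>
  define \<eta> where "\<eta> = (1 - 2 * \<epsilon>) / 3"
  have \<eta>: "0 < \<eta>" "\<eta> < 1" using assms by (auto simp: \<eta>_def)
  have "\<epsilon> + \<eta> < 1 - \<eta> - \<epsilon>" using assms by (simp add: \<eta>_def field_simps)
  also have "\<dots> \<le> (1 - \<eta>) * (1 - \<epsilon>)" using assms \<eta> by (simp add: algebra_simps)
  finally have sep: "\<epsilon> + \<eta> < (1 - \<eta>) * (1 - \<epsilon>)" .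
  obtain c :: nat where c: "4 / \<eta> + 2 \<le> real c" using real_arch_simple by blast
  have "0 < 4 / \<eta>" using \<eta> by simp
  then have c2: "2 \<le> c" using c by linarith
  have c4: "4 / (real c - 1) \<le> \<eta>"
    using c c2 \<eta> by (simp add: field_simps)
  have "1 / real c * real N powr (2/3) \<le> real (mpoly_degree p)"
    if N: "1 \<le> N" and p: "mpoly_vars p \<subseteq> {1..N^2}" "approximates \<epsilon> p (and_or_tree N)" for N p
  proof -
    have "N < c * (N + 1)^2" using c2 mult_mono[of 1 c "N + 1" "(N + 1)^2"] by (simp add: power2_eq_square)
    \<comment> \<open>\<open>d\<close> is maximal with \<open>c * d^2 \<le> N\<close>: the first
      bound admits \<open>d\<close> in \<open>degree_ge_square\<close>, the second gives
      \<open>N < c * (d + 1)^2\<close>.\<close>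
    then obtain d where d: "\<not> N < c * d^2" "N < c * Suc d ^ 2"
      using ex_least_nat_less[of "\<lambda>k. N < c * k^2" "N + 1"] by auto
    have deg: "(d + 1)^2 \<le> mpoly_degree p"
      using degree_ge_square[of \<epsilon> \<eta> N c d p] assms \<eta> sep c2 c4 N p d by simp
    \<comment> \<open>The degree is in fact at least \<open>N / c\<close>; since
      \<open>N \<ge> 1\<close>, this implies the bound with exponent 2/3.\<close>
    have "real N powr (2/3) \<le> real N powr 1" using N by (intro powr_mono) auto
    also have "\<dots> = real N" using N by simp
    also have "\<dots> \<le> real (c * (d + 1)^2)" using d(2) unfolding of_nat_le_iff by simp
    also have "\<dots> \<le> real c * real (mpoly_degree p)"
      unfolding of_nat_mult using deg by (intro mult_left_mono) (simp_all only: of_nat_le_iff of_nat_0_le_iff)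
    finally show ?thesis using c2 by (simp add: field_simps)
  qed
  then show ?thesis using c2 by (intro exI[of _ "1 / real c"] conjI exI[of _ 1]) auto
qed

end
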